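(* For every positive integer $n$, the maximum number of rational subset sums in $n$-element sets of irrational numbers is $$\mathrm{h}(n)=\binom{n}{\lfloor \frac{n}{2} \rfloor}.$$
   Context: For a finite set $A$ of irrational real numbers, let $\mathcal{H}(A)$ denote the set of subsets $A'\subseteq A$ for which $\sum_{x\in A'} x\in \mathbb{Q}$; the empty subset (with sum $0$) is counted. Define $\mathrm{h}(n):=\max_{A} |\mathcal{H}(A)|$, the maximum being over all sets $A$ of $n$ (distinct) irrational real numbers. *)

theory Defs
  imports "HOL-Analysis.Analysis"
begin

definition rational_sum_subsets :: "real set \<Rightarrow> real set set"
  where "rational_sum_subsets A = {A'. A' \<subseteq> A \<and> (\<Sum>x\<in>A'. x) \<in> \<rat>}"

definition max_rational_sums :: "nat \<Rightarrow> nat"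
  where "max_rational_sums n =
    Max {card (rational_sum_subsets A) | A. finite A \<and> card A = n \<and> (\<forall>x\<in>A. x \<notin> \<rat>)}"

text \<open>
  The two lemmas below show that \<open>Max\<close> in the definition above is a genuine maximum:
  it is taken over a finite nonempty set for every \<open>n\<close>.
\<close>

lemma finite_max_rational_sums_set:
  "finite {card (rational_sum_subsets A) | A. finite A \<and> card A = n \<and> (\<forall>x\<in>A. x \<notin> \<rat>)}"
proof (rule finite_subset)
  show "{card (rational_sum_subsets A) | A. finite A \<and> card A = n \<and> (\<forall>x\<in>A. x \<notin> \<rat>)} \<subseteq> {..2 ^ n}"
  proof
    fix k
    assume "k \<in> {card (rational_sum_subsets A) | A. finite A \<and> card A = n \<and> (\<forall>x\<in>A. x \<notin> \<rat>)}"
    then obtain A where k: "k = card (rational_sum_subsets A)" and fin: "finite A" and n: "card A = n"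
      by blast
    have "rational_sum_subsets A \<subseteq> Pow A"
      by (auto simp: rational_sum_subsets_def)
    then have "card (rational_sum_subsets A) \<le> card (Pow A)"
      using fin by (intro card_mono) auto
    then show "k \<in> {..2 ^ n}"
      using fin k n by (simp add: card_Pow)
  qed
qed simp

lemma nonempty_max_rational_sums_set:
  "{card (rational_sum_subsets A) | A. finite A \<and> card A = n \<and> (\<forall>x\<in>A. x \<notin> \<rat>)} \<noteq> {}"
proof -
  have "uncountable (UNIV - \<rat> :: real set)"
    by (intro uncountable_minus_countable uncountable_UNIV_real countable_rat)
  then have "infinite (UNIV - \<rat> :: real set)"
    using countable_finite by blast
  then obtain A where "finite A" "card A = n" "A \<subseteq> (UNIV - \<rat> :: real set)"
    using infinite_arbitrarily_large by blast
  then show ?thesis by blast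
qed

end

theory Submission
  imports Defs
begin

text \<open>
  Upper bound: irrationality of each \<open>x \<in> A\<close> means that \<open>x\<close> and \<open>1\<close> are linearly independent
  over the rationals, so some \<open>\<rat>\<close>-linear functional kills \<open>1\<close> but not \<open>x\<close>; a generic
  combination of these functionals kills \<open>1\<close> and no element of \<open>A\<close>
  (\<open>rat_functional_nonzero_on\<close>). It vanishes on every rational subset sum, so the question becomes
  how many subsets of \<open>n\<close> nonzero elements of an ordered group have sum \<open>0\<close>. This is
  the Littlewood--Offord problem (\<open>Littlewood_Offord\<close>): taking the symmetric difference with the
  set of negative elements turns subsets with a prescribed sum under the given weights into
  subsets with a prescribed sum under positive weights, and these form an antichain.
  Sperner's theorem bounds an antichain by the central binomial coefficient.

  Lower bound: let \<open>A\<close> consist of \<open>\<lfloor>n/2\<rfloor>\<close> rational translates of an irrational \<open>t\<close> and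
  \<open>\<lceil>n/2\<rceil>\<close> rational translates of \<open>-t\<close>. A subset containing equally many of either kind has a
  rational sum. The symmetric difference with the first kind turns the subsets of size
  \<open>\<lfloor>n/2\<rfloor>\<close> into precisely these balanced subsets, so there are enough of them.
\<close>

section \<open>Sperner's theorem\<close>

text \<open>
  The inequality is an average of its instances for the sets \<open>S - {s}\<close>. For \<open>s \<in> S\<close> the members
  of \<open>F\<close> that avoid \<open>s\<close> form an antichain in \<open>S - {s}\<close>. Summing over \<open>s\<close> counts each member
  \<open>A\<close> once for every element of \<open>S - A\<close>, and
  \<open>(n - k) / (n - 1 choose k) = n / (n choose k)\<close> is the weight it must receive. The identity
  fails only for \<open>A = S\<close>, and an antichain containing \<open>S\<close> has no other member.
\<close>

lemma LYM_inequality: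
  assumes "finite S" and "F \<subseteq> Pow S" and "pairwise (\<lambda>A B. \<not> A \<subseteq> B) F"
  shows "(\<Sum>A\<in>F. 1 / real (card S choose card A)) \<le> 1"
  using assms
proof (induction "card S" arbitrary: S F)
  case 0
  then have "F \<subseteq> {{}}" by auto
  then have "F = {} \<or> F = {{}}" by blast
  then show ?case by auto
next
  case (Suc m)
  have finF: "finite F"
    using Suc.prems by (meson finite_Pow_iff finite_subset)
  show ?case
  proof (cases "S \<in> F")
    case True
    then have "A = S" if "A \<in> F" for A
      using Suc.prems(2,3) that unfolding pairwise_def by blast
    with True have "F = {S}" by blast
    then show ?thesis by simp
  next
    case False
    have weight: "real (Suc m) * (1 / real (Suc m choose card A))
        = (\<Sum>s\<in>{s. s \<in> S \<and> s \<notin> A}. 1 / real (m choose card A))" if "A \<in> F" for A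
    proof -
      have A: "A \<subset> S" using that False Suc.prems by auto
      then have lt: "card A < Suc m"
        using Suc psubset_card_mono by metis
      have "{s. s \<in> S \<and> s \<notin> A} = S - A" by auto
      then have c: "card {s. s \<in> S \<and> s \<notin> A} = Suc m - card A"
        using A Suc.hyps(2) Suc.prems(1) card_Diff_subset[of A S] by (auto intro: finite_subset)
      have "(Suc m - card A) * (Suc m choose card A) = Suc m * (m choose card A)"
        using binomial_absorb_comp[of "Suc m" "card A"] by simp
      then have "real (Suc m - card A) * real (Suc m choose card A)
          = real (Suc m) * real (m choose card A)"
        by (metis of_nat_mult)
      moreover have "0 < Suc m choose card A" "0 < m choose card A"
        using lt by (auto simp: zero_less_binomial)
      ultimately show ?thesis
        by (simp add: c field_simps del: binomial_Suc_Suc of_nat_Suc)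
    qed
    have "real (Suc m) * (\<Sum>A\<in>F. 1 / real (Suc m choose card A))
        = (\<Sum>A\<in>F. \<Sum>s\<in>{s. s \<in> S \<and> s \<notin> A}. 1 / real (m choose card A))"
      unfolding sum_distrib_left by (rule sum.cong[OF refl weight])
    also have "\<dots> = (\<Sum>s\<in>S. \<Sum>A\<in>{A. A \<in> F \<and> s \<notin> A}. 1 / real (m choose card A))"
      by (rule sum.swap_restrict[OF finF Suc.prems(1)])
    also have "\<dots> \<le> (\<Sum>s\<in>S. 1)"
    proof (rule sum_mono)
      fix s assume "s \<in> S"
      then have m: "m = card (S - {s})"
        using Suc.hyps(2) by simp
      show "(\<Sum>A\<in>{A. A \<in> F \<and> s \<notin> A}. 1 / real (m choose card A)) \<le> 1"
        unfolding m
      proof (rule Suc.hyps(1)[OF m])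
        show "{A. A \<in> F \<and> s \<notin> A} \<subseteq> Pow (S - {s})"
          using Suc.prems(2) by blast
      qed (use Suc.prems in \<open>auto simp: pairwise_def\<close>)
    qed
    also have "\<dots> = real (Suc m) * 1"
      using Suc.hyps(2) by simp
    finally show ?thesis
      unfolding Suc.hyps(2)[symmetric] by (rule mult_left_le_imp_le) simp
  qed
qed

lemma Sperner:
  assumes "finite S" and "F \<subseteq> Pow S" and "pairwise (\<lambda>A B. \<not> A \<subseteq> B) F"
  shows "card F \<le> card S choose (card S div 2)"
proof -
  let ?b = "card S choose (card S div 2)"
  have b: "0 < ?b" by (simp add: zero_less_binomial)
  have "real (card F) * (1 / real ?b) = (\<Sum>A\<in>F. 1 / real ?b)"
    by simp
  also have "\<dots> \<le> (\<Sum>A\<in>F. 1 / real (card S choose card A))"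
  proof (rule sum_mono)
    fix A assume "A \<in> F"
    then have "card A \<le> card S"
      using assms by (auto intro: card_mono)
    then show "1 / real ?b \<le> 1 / real (card S choose card A)"
      by (intro divide_left_mono) (auto simp: binomial_maximum zero_less_binomial)
  qed
  also have "\<dots> \<le> 1"
    by (rule LYM_inequality[OF assms])
  finally show ?thesis
    using b by (simp add: field_simps)
qed

section \<open>Subsets with a prescribed sum\<close>

lemma inj_sym_diff: "inj (\<lambda>B. sym_diff B N)"
proof (rule injI)
  fix B C :: "'a set" assume "sym_diff B N = sym_diff C N"
  then have "sym_diff (sym_diff B N) N = sym_diff (sym_diff C N) N" by simp
  then show "B = C" by blast
qed

lemma Littlewood_Offord:
  fixes a :: "'a \<Rightarrow> 'b::{linordered_ab_group_add, ordered_ab_group_add_abs}"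
  assumes fin: "finite S" and nz: "\<And>x. x \<in> S \<Longrightarrow> a x \<noteq> 0"
  shows "card {B. B \<subseteq> S \<and> sum a B = c} \<le> card S choose (card S div 2)"
proof -
  define N where "N = {x \<in> S. a x < 0}"
  define F where "F = {C. C \<subseteq> S \<and> (\<Sum>x\<in>C. \<bar>a x\<bar>) = c - sum a N}"
  have "N \<subseteq> S" by (auto simp: N_def)
  (* An element y of N contributes a y or 0 to the sum over B. After the swap it contributes
     0 or -a y, which is larger by -a y in either case. *)
  have "(\<Sum>x\<in>sym_diff B N. \<bar>a x\<bar>) = sum a B - sum a N" if "B \<subseteq> S" for B
  proof -
    have finB: "finite B" "finite N"
      using that \<open>N \<subseteq> S\<close> fin finite_subset by auto
    have "(\<Sum>x\<in>sym_diff B N. \<bar>a x\<bar>) = (\<Sum>x\<in>B - N. \<bar>a x\<bar>) + (\<Sum>x\<in>N - B. \<bar>a x\<bar>)"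
      using finB by (intro sum.union_disjoint) auto
    also have "(\<Sum>x\<in>B - N. \<bar>a x\<bar>) = sum a (B - N)"
      using that by (intro sum.cong) (auto simp: N_def)
    also have "(\<Sum>x\<in>N - B. \<bar>a x\<bar>) = - sum a (N - B)"
      unfolding sum_negf[symmetric] by (intro sum.cong) (auto simp: N_def)
    also have "sum a (B - N) = sum a B - sum a (B \<inter> N)"
      using finB sum.Int_Diff[of B a N] by (simp add: algebra_simps)
    also have "sum a (N - B) = sum a N - sum a (B \<inter> N)"
      using finB sum.Int_Diff[of N a B] by (simp add: algebra_simps Int_commute)
    finally show ?thesis by simp
  qed
  then have "(\<lambda>B. sym_diff B N) ` {B. B \<subseteq> S \<and> sum a B = c} \<subseteq> F"
    using \<open>N \<subseteq> S\<close> by (auto simp: F_def)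
  moreover have "finite F"
    unfolding F_def using fin by simp
  ultimately have "card {B. B \<subseteq> S \<and> sum a B = c} \<le> card F"
    by (rule card_inj_on_le[OF inj_on_subset[OF inj_sym_diff subset_UNIV]])
  also have "\<dots> \<le> card S choose (card S div 2)"
  proof (rule Sperner[OF fin])
    show "pairwise (\<lambda>C D. \<not> C \<subseteq> D) F"
    proof (rule pairwiseI, rule notI)
      fix C D assume C: "C \<in> F" and D: "D \<in> F" and "C \<noteq> D" "C \<subseteq> D"
      then obtain y where y: "y \<in> D - C" by blast
      then have "0 < \<bar>a y\<bar>"
        using D nz by (auto simp: F_def)
      then have "(\<Sum>x\<in>C. \<bar>a x\<bar>) < (\<Sum>x\<in>D. \<bar>a x\<bar>)"
        using D \<open>C \<subseteq> D\<close> y fin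
        by (intro sum_strict_mono2[where b = y]) (auto simp: F_def intro: finite_subset)
      then show False
        using C D by (simp add: F_def)
    qed
  qed (auto simp: F_def)
  finally show ?thesis .
qed

section \<open>Rational functionals that avoid finitely many irrationals\<close>

abbreviation rat_scale :: "rat \<Rightarrow> real \<Rightarrow> real"
  where "rat_scale q x \<equiv> of_rat q * x"

interpretation rat_real: vector_space_pair rat_scale "(*) :: rat \<Rightarrow> rat \<Rightarrow> rat"
  by unfold_locales (auto simp: algebra_simps of_rat_add of_rat_mult)

abbreviation rat_functional :: "(real \<Rightarrow> rat) \<Rightarrow> bool"
  where "rat_functional \<equiv> Vector_Spaces.linear rat_scale (*)"

lemma rat_functional_separates_irrational:
  assumes "x \<notin> \<rat>"
  obtains g where "rat_functional g" and "g 1 = 0" and "g x = 1"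
proof -
  have "x \<notin> rat_real.vs1.span {1}"
    using assms by (auto simp: rat_real.vs1.span_singleton)
  then have ind: "rat_real.vs1.independent {x, 1}"
    by (intro rat_real.vs1.independent_insertI) (simp_all add: rat_real.vs1.independent_empty)
  have "x \<noteq> 1" using assms by auto
  let ?g = "rat_real.construct {x, 1} (\<lambda>y. if y = x then 1 else 0)"
  show thesis
  proof
    show "rat_functional ?g" by (rule rat_real.linear_construct[OF ind])
    show "?g 1 = 0" "?g x = 1"
      using rat_real.construct_basis[OF ind] \<open>x \<noteq> 1\<close> by auto
  qed
qed

text \<open>
  A generic combination \<open>f + c g\<close> keeps the values of \<open>f\<close> nonzero while repairing one more
  point: each point excludes at most one value of \<open>c\<close>, and there are infinitely many rationals.
\<close>

lemma rat_functional_nonzero_on: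
  assumes "finite A" and "\<And>x. x \<in> A \<Longrightarrow> x \<notin> \<rat>"
  shows "\<exists>f. rat_functional f \<and> f 1 = 0 \<and> (\<forall>x\<in>A. f x \<noteq> 0)"
  using assms
proof (induction A rule: finite_induct)
  case empty
  have "rat_functional (\<lambda>x. 0)"
    by (rule rat_real.linear_zero)
  then show ?case by auto
next
  case (insert x A)
  then obtain f where f: "rat_functional f" "f 1 = 0" "\<forall>y\<in>A. f y \<noteq> 0"
    by auto
  obtain g where g: "rat_functional g" "g 1 = 0" "g x = 1"
    using rat_functional_separates_irrational insert.prems by blast
  have "finite ((\<lambda>y. - f y / g y) ` insert x A)"
    using insert.hyps by simp
  then obtain c where c: "c \<notin> (\<lambda>y. - f y / g y) ` insert x A"
    using ex_new_if_finite[OF infinite_UNIV_char_0] by blast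
  have "f y + c * g y \<noteq> 0" if y: "y \<in> insert x A" for y
  proof
    assume zero: "f y + c * g y = 0"
    have "g y \<noteq> 0"
      using zero y f(3) g(3) by auto
    then have "c = - f y / g y"
      using zero by (simp add: field_simps add_eq_0_iff)
    with c y show False by blast
  qed
  moreover have "rat_functional (\<lambda>y. f y + c * g y)"
    using f(1) g(1) by (intro rat_real.linear_compose_add rat_real.linear_compose_scale_right)
  ultimately show ?case
    using f(2) g(2) by (intro exI[of _ "\<lambda>y. f y + c * g y"]) simp
qed

section \<open>The two bounds\<close>

lemma card_rational_sum_subsets_le:
  assumes "finite A" and "\<And>x. x \<in> A \<Longrightarrow> x \<notin> \<rat>"
  shows "card (rational_sum_subsets A) \<le> card A choose (card A div 2)"
proof -
  obtain f where lin: "rat_functional f" and f1: "f 1 = 0" and nz: "\<And>x. x \<in> A \<Longrightarrow> f x \<noteq> 0"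
    using rat_functional_nonzero_on[OF assms] by blast
  interpret f: Vector_Spaces.linear rat_scale "(*)" f by (fact lin)
  have f_Rats: "f r = 0" if "r \<in> \<rat>" for r
    using that
  proof (cases r rule: Rats_cases)
    case (of_rat q)
    then show ?thesis
      using f.scale[of q 1] f1 by simp
  qed
  have "rational_sum_subsets A \<subseteq> {B. B \<subseteq> A \<and> sum f B = 0}"
    using f_Rats by (auto simp: rational_sum_subsets_def f.sum[symmetric])
  then have "card (rational_sum_subsets A) \<le> card {B. B \<subseteq> A \<and> sum f B = 0}"
    using assms(1) by (intro card_mono) auto
  also have "\<dots> \<le> card A choose (card A div 2)"
    by (rule Littlewood_Offord[OF assms(1) nz])
  finally show ?thesis .
qed

lemma sum_minus_multiple_in_Rats:
  fixes t :: real
  assumes "\<And>x. x \<in> X \<Longrightarrow> x - t \<in> \<rat>"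
  shows "(\<Sum>x\<in>X. x) - of_nat (card X) * t \<in> \<rat>"
proof -
  have "(\<Sum>x\<in>X. x - t) \<in> \<rat>"
    using assms by (rule Rats_sum)
  then show ?thesis by (simp add: sum_subtractf)
qed

text \<open>
  A set \<open>R\<close> of size \<open>card P\<close> satisfies \<open>card (R - P) = card (P - R)\<close>, so the symmetric difference
  of \<open>R\<close> and \<open>P\<close> consists of equally many translates of \<open>-t\<close>, from \<open>R - P\<close>, and of \<open>t\<close>, from
  \<open>P - R\<close>. The multiples of \<open>t\<close> cancel in its sum.
\<close>

lemma card_rational_sum_subsets_ge:
  fixes t :: real
  assumes finP: "finite P" and finQ: "finite Q"
    and P: "\<And>x. x \<in> P \<Longrightarrow> x - t \<in> \<rat>" and Q: "\<And>x. x \<in> Q \<Longrightarrow> x - (- t) \<in> \<rat>"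
  shows "card (P \<union> Q) choose card P \<le> card (rational_sum_subsets (P \<union> Q))"
proof -
  let ?\<R> = "{R. R \<subseteq> P \<union> Q \<and> card R = card P}"
  have "(\<Sum>x\<in>sym_diff R P. x) \<in> \<rat>" if "R \<in> ?\<R>" for R
  proof -
    have R: "R \<subseteq> P \<union> Q" "card R = card P" using that by auto
    then have finR: "finite R" using finP finQ finite_subset by blast
    have "card (R - P) = card (P - R)"
      using card_Diff_subset_Int[of R P] card_Diff_subset_Int[of P R] finP finR R(2)
      by (simp add: Int_commute)
    moreover have "(\<Sum>x\<in>R - P. x) - of_nat (card (R - P)) * (- t) \<in> \<rat>"
      using R(1) Q by (intro sum_minus_multiple_in_Rats) auto
    moreover have "(\<Sum>x\<in>P - R. x) - of_nat (card (P - R)) * t \<in> \<rat>"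
      using P by (intro sum_minus_multiple_in_Rats) auto
    ultimately have "(\<Sum>x\<in>R - P. x) + (\<Sum>x\<in>P - R. x) \<in> \<rat>"
      using Rats_add by fastforce
    moreover have "(\<Sum>x\<in>sym_diff R P. x) = (\<Sum>x\<in>R - P. x) + (\<Sum>x\<in>P - R. x)"
      using finP finR by (intro sum.union_disjoint) auto
    ultimately show ?thesis by simp
  qed
  then have "(\<lambda>R. sym_diff R P) ` ?\<R> \<subseteq> rational_sum_subsets (P \<union> Q)"
    by (auto simp: rational_sum_subsets_def)
  moreover have "finite (rational_sum_subsets (P \<union> Q))"
    using finP finQ by (simp add: rational_sum_subsets_def)
  ultimately have "card ?\<R> \<le> card (rational_sum_subsets (P \<union> Q))"
    by (rule card_inj_on_le[OF inj_on_subset[OF inj_sym_diff subset_UNIV]])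
  then show ?thesis
    using finP finQ by (simp add: n_subsets)
qed

lemma exists_central_rational_sums:
  obtains A where "finite A" and "card A = n" and "\<And>x. x \<in> A \<Longrightarrow> x \<notin> \<rat>"
    and "n choose (n div 2) \<le> card (rational_sum_subsets A)"
proof -
  obtain t :: real where t: "t \<notin> \<rat>"
    using countable_rat uncountable_UNIV_real by (metis UNIV_eq_I)
  define P where "P = (\<lambda>i. t + real i) ` {..<n div 2}"
  define Q where "Q = (\<lambda>j. - t + real j) ` {..<n - n div 2}"
  have cards: "card P = n div 2" "card Q = n - n div 2"
    by (simp_all add: P_def Q_def card_image inj_on_def)
  have fin: "finite P" "finite Q"
    by (simp_all add: P_def Q_def)
  have disj: "P \<inter> Q = {}"
  proof (rule ccontr)
    assume "P \<inter> Q \<noteq> {}"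
    then obtain i j where "t + real i = - t + real j"
      by (auto simp: P_def Q_def)
    then have "t = (real j - real i) / 2" by simp
    moreover have "(real j - real i) / 2 \<in> \<rat>" by simp
    ultimately show False using t by metis
  qed
  have card: "card (P \<union> Q) = n"
    using card_Un_disjoint[OF fin disj] cards by simp
  show thesis
  proof
    show "x \<notin> \<rat>" if "x \<in> P \<union> Q" for x
    proof
      assume x: "x \<in> \<rat>"
      from that consider i where "t = x - real i" | j where "t = real j - x"
        by (auto simp: P_def Q_def)
      then have "t \<in> \<rat>"
        using x by cases simp_all
      with t show False by blast
    qed
    show "n choose (n div 2) \<le> card (rational_sum_subsets (P \<union> Q))"
    proof -
      have "card (P \<union> Q) choose card P \<le> card (rational_sum_subsets (P \<union> Q))"
        by (rule card_rational_sum_subsets_ge[OF fin, of t]) (auto simp: P_def Q_def)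
      then show ?thesis unfolding card cards .
    qed
  qed (use fin card in auto)
qed

theorem theorem1p10:
  fixes n :: nat
  assumes "n \<ge> 1"
  shows "max_rational_sums n = n choose (n div 2)"
proof -
  obtain A where "finite A" "card A = n" "\<And>x. x \<in> A \<Longrightarrow> x \<notin> \<rat>"
    and "n choose (n div 2) \<le> card (rational_sum_subsets A)"
    using exists_central_rational_sums by blast
  moreover from this have "card (rational_sum_subsets A) = n choose (n div 2)"
    using card_rational_sum_subsets_le[of A] by simp
  ultimately have "n choose (n div 2)
      \<in> {card (rational_sum_subsets A) | A. finite A \<and> card A = n \<and> (\<forall>x\<in>A. x \<notin> \<rat>)}"
    by (smt (verit) mem_Collect_eq)
  moreover have "k \<le> n choose (n div 2)"
    if "k \<in> {card (rational_sum_subsets A) | A. finite A \<and> card A = n \<and> (\<forall>x\<in>A. x \<notin> \<rat>)}" for k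
    using that card_rational_sum_subsets_le by blast
  ultimately show ?thesis
    unfolding max_rational_sums_def by (intro Max_eqI finite_max_rational_sums_set)
qed

end
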